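(* Let $P$ be a $p$-program (a finite program whose only predicate different from (in)equality is $p$), with $p$ of arity $n$, let $U$ be a universe for $P$ and let $M$ be a set of ground atoms $p(\mathbf{x})$ with $\mathbf{x}\in U^n$. Then $(U,M)$ is an open answer set of $P$ if and only if $(U, M\cup R)$ is a model of $\bigwedge \mathrm{comp}(P)$, where $$R \equiv \{\, r(\mathbf{y}) \mid r[\mathbf{Y}\mid\mathbf{y}] : \alpha[\,]\leftarrow\beta[\,] \in P_U,\ M\models \alpha[\,]^{-}\cup \mathrm{not}\,\beta[\,]^{-},\ \mathrm{vars}(r)=\mathbf{Y} \,\}.$$
   Context: **Open answer set programming.** Terms are constants and variables (no function symbols). A literal is an atom $q(\mathbf{t})$ or a naf-atom $\mathrm{not}\,q(\mathbf{t})$. Equality is a binary predicate; $t\neq s$ stands for $\mathrm{not}\,(t=s)$. A regular atom is an atom that is not an equality atom. For a set $\alpha$ of literals, $\alpha^+$ is the set of atoms in $\alpha$ and $\alpha^-=\{a \mid \mathrm{not}\,a\in\alpha\}$; for a set $X$ of atoms, $\mathrm{not}\,X=\{\mathrm{not}\,a\mid a\in X\}$. A rule is $\alpha\leftarrow\beta$ with $\alpha,\beta$ finite sets of literals, $|\alpha^+|\le 1$, and $\alpha^+$ containing no equality atom ($\alpha$ is read disjunctively, $\beta$ conjunctively). A program is a finite set of rules (infinite sets of ground rules arise only by grounding). A universe $U$ for $P$ is a non-empty countable superset of the set of constants of $P$. $P_U$ is the ground program obtained by substituting variables of $P$ by elements of $U$ in all possible ways; $o[\mathbf{Y}\mid\mathbf{y}]$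 (or $o[\,]$) denotes grounding of $o$ by substituting $\mathbf{y}$ for $\mathbf{Y}$. For a set $I$ of ground regular atoms, $I\models a$ iff $a\in I$ for regular $a$; $I\models t=s$ iff $t,s$ are the same element; $I\models \mathrm{not}\,a$ iff $I\not\models a$; $I\models X$ iff $I$ satisfies every element of $X$. $I$ satisfies a ground rule $\alpha\leftarrow\beta$ if $I\models l$ for some $l\in\alpha$ whenever $I\models\beta$. For a ground program without $\mathrm{not}$, an answer set is a subset-minimal model. For a ground program $Q$, the GL-reduct is $Q^I=\{\alpha^+\leftarrow\beta^+ \mid \alpha\leftarrow\beta\in Q,\ I\models\mathrm{not}\,\beta^-,\ I\models\alpha^-\}$, and $I$ is an answer set of $Q$ if it is an answer set of $Q^I$. An open answer set of $P$ is a pair $(U,M)$ with $U$ a universe for $P$, $M$ a set of ground regular atoms over the predicates of $P$ and $U$, and $M$ an answer set of $P_U$. **Fixed point logic (FPL).** First-order logic with equality (interpreted as identity) extended with formulas $[\mathrm{LFP}\,W\mathbf{X}.\psi(W,\mathbf{X})](\mathbf{X})$, with $W$ an $n$-ary predicate variable occurring only positively in $\psi$, and all free variables of $\psi$ in $\mathbf{X}$; $(U,M)\models[\mathrm{LFP}\,W\mathbf{X}.\psi](\mathbf{x})$ iff $\mathbf{x}$ belongs to the least fixed point of $S\mapsto\{\mathbf{x}\in U^n\mid (U,M),W\to S\models\psi(W,\mathbf{x})\}$. An interpretation is written $(U,N)$ with $U$ the domain and $N$ the set of true ground atoms; constants of $P$ are interpreted as themselves. **The completion.** In formulas, $\mathrm{not}\,a$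 is read as $\neg a$; $\bigwedge\emptyset=\mathbf{true}$ and $\bigvee\emptyset=\mathbf{false}$. Each rule of $P$ has a unique name $r$, also used as a new predicate symbol whose arity is the number of variables of the rule. $\mathrm{comp}(P)$ consists of: - $a\neq b$ for every pair of different constants $a,b$ in $P$, and $\exists X.\mathbf{true}$; - for every rule $\alpha\leftarrow\beta\in P$ with variables $\mathbf{Y}$: $\forall\mathbf{Y}.\ \bigwedge\beta\Rightarrow\bigvee\alpha$; - for every rule $r:\alpha\leftarrow\beta\in P$ with variables $\mathbf{Y}$: $\forall\mathbf{Y}.\ r(\mathbf{Y})\Leftrightarrow\bigwedge\alpha^-\wedge\bigwedge\neg\beta^-$; - $\forall\mathbf{X}.\ p(\mathbf{X})\Rightarrow[\mathrm{LFP}\,W\mathbf{X}.\phi(W,\mathbf{X})](\mathbf{X})$, where $\mathbf{X}=X_1,\dots,X_n$ are new variables, $\phi(W,\mathbf{X})\equiv W(\mathbf{X})\vee\bigvee_{r:\,p(\mathbf{t})\vee\alpha\leftarrow\beta\,\in P}E(r)$ and $E(r)\equiv\exists\mathbf{Y}.\ X_1=t_1\wedge\dots\wedge X_n=t_n\wedge\bigwedge\beta^+[p|W]\wedge r(\mathbf{Y})$, with $\mathbf{Y}$ the variables of $r$ and $\beta^+[p|W]$ being $\beta^+$ with $p$ replaced by the predicate variable $W$. *)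

theory Defs
  imports "HOL-Library.FSet" "HOL-Library.Countable_Set"
begin

section \<open>Open answer set programming\<close>

text \<open>Constants and universe elements share the type \<open>'c\<close>, so that constants denote themselves.
  Atoms are parametrised by their arguments: \<open>('p, 'c trm) atom\<close> for atoms that may contain
  variables, and \<open>('p, 'c) atom\<close> for ground ones.\<close>

type_synonym var = nat

datatype 'c trm = Var var | Const 'c

datatype ('p, 't) atom = Pred 'p "'t list" | Eq 't 't

datatype ('p, 't) literal = is_Pos: Pos (atm: "('p, 't) atom") | Naf (atm: "('p, 't) atom")

datatype ('p, 't) rule =
  Rule (head: "('p, 't) literal fset") (body: "('p, 't) literal fset")

primrec regular :: "('p, 't) atom \<Rightarrow> bool" where
  "regular (Pred q ts) = True"
| "regular (Eq s t) = False"

definition pos :: "('p, 't) literal fset \<Rightarrow> ('p, 't) atom fset" where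
  "pos L = atm |`| ffilter is_Pos L"

definition neg :: "('p, 't) literal fset \<Rightarrow> ('p, 't) atom fset" where
  "neg L = atm |`| ffilter (\<lambda>l. \<not> is_Pos l) L"

definition is_rule :: "('p, 't) rule \<Rightarrow> bool" where
  "is_rule r \<longleftrightarrow> fcard (pos (head r)) \<le> 1 \<and> (\<forall>a |\<in>| pos (head r). regular a)"

definition is_program :: "('p, 'c trm) rule fset \<Rightarrow> bool" where
  "is_program P \<longleftrightarrow> (\<forall>r |\<in>| P. is_rule r)"

subsection \<open>Variables, constants and predicates of a program\<close>

primrec args :: "('p, 't) atom \<Rightarrow> 't list" where
  "args (Pred q ts) = ts"
| "args (Eq s t) = [s, t]"

primrec trm_vars :: "'c trm \<Rightarrow> var fset" where
  "trm_vars (Var x) = {|x|}"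
| "trm_vars (Const c) = {||}"

primrec trm_consts :: "'c trm \<Rightarrow> 'c fset" where
  "trm_consts (Var x) = {||}"
| "trm_consts (Const c) = {|c|}"

definition atoms :: "('p, 't) rule \<Rightarrow> ('p, 't) atom fset" where
  "atoms r = atm |`| (head r |\<union>| body r)"

definition trms :: "('p, 't) rule \<Rightarrow> 't fset" where
  "trms r = ffUnion ((\<lambda>a. fset_of_list (args a)) |`| atoms r)"

definition vars :: "('p, 'c trm) rule \<Rightarrow> var fset" where
  "vars r = ffUnion (trm_vars |`| trms r)"

definition prog_vars :: "('p, 'c trm) rule fset \<Rightarrow> var fset" where
  "prog_vars P = ffUnion (vars |`| P)"

definition prog_consts :: "('p, 'c trm) rule fset \<Rightarrow> 'c fset" where
  "prog_consts P = ffUnion ((\<lambda>r. ffUnion (trm_consts |`| trms r)) |`| P)"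

text \<open>The predicates of a program other than equality, each paired with its arity.\<close>

definition prog_preds :: "('p, 'c trm) rule fset \<Rightarrow> ('p \<times> nat) set" where
  "prog_preds P = {(q, length ts) | q ts. \<exists>r |\<in>| P. Pred q ts |\<in>| atoms r}"

subsection \<open>Grounding\<close>

definition universe :: "('p, 'c trm) rule fset \<Rightarrow> 'c set \<Rightarrow> bool" where
  "universe P U \<longleftrightarrow> U \<noteq> {} \<and> countable U \<and> fset (prog_consts P) \<subseteq> U"

primrec val :: "(var \<Rightarrow> 'c) \<Rightarrow> 'c trm \<Rightarrow> 'c" where
  "val \<sigma> (Var x) = \<sigma> x"
| "val \<sigma> (Const c) = c"

abbreviation ground_rule :: "(var \<Rightarrow> 'c) \<Rightarrow> ('p, 'c trm) rule \<Rightarrow> ('p, 'c) rule" where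
  "ground_rule \<sigma> \<equiv> map_rule id (val \<sigma>)"

definition ground :: "('p, 'c trm) rule fset \<Rightarrow> 'c set \<Rightarrow> ('p, 'c) rule set" where
  "ground P U = {ground_rule \<sigma> r | r \<sigma>. r |\<in>| P \<and> (\<forall>x |\<in>| vars r. \<sigma> x \<in> U)}"

subsection \<open>Answer sets\<close>

primrec sat_atom :: "('p, 'c) atom set \<Rightarrow> ('p, 'c) atom \<Rightarrow> bool" where
  "sat_atom I (Pred q cs) \<longleftrightarrow> Pred q cs \<in> I"
| "sat_atom I (Eq c d) \<longleftrightarrow> c = d"

primrec sat_lit :: "('p, 'c) atom set \<Rightarrow> ('p, 'c) literal \<Rightarrow> bool" where
  "sat_lit I (Pos a) \<longleftrightarrow> sat_atom I a"
| "sat_lit I (Naf a) \<longleftrightarrow> \<not> sat_atom I a"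

definition sat_lits :: "('p, 'c) atom set \<Rightarrow> ('p, 'c) literal fset \<Rightarrow> bool" where
  "sat_lits I L \<longleftrightarrow> (\<forall>l |\<in>| L. sat_lit I l)"

definition sat_rule :: "('p, 'c) atom set \<Rightarrow> ('p, 'c) rule \<Rightarrow> bool" where
  "sat_rule I \<rho> \<longleftrightarrow> (sat_lits I (body \<rho>) \<longrightarrow> (\<exists>l |\<in>| head \<rho>. sat_lit I l))"

definition ground_model :: "('p, 'c) rule set \<Rightarrow> ('p, 'c) atom set \<Rightarrow> bool" where
  "ground_model Q I \<longleftrightarrow> (\<forall>a\<in>I. regular a) \<and> (\<forall>\<rho>\<in>Q. sat_rule I \<rho>)"

definition minimal_model :: "('p, 'c) rule set \<Rightarrow> ('p, 'c) atom set \<Rightarrow> bool" where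
  "minimal_model Q I \<longleftrightarrow> ground_model Q I \<and> \<not> (\<exists>J. J \<subset> I \<and> ground_model Q J)"

definition reduct :: "('p, 'c) rule set \<Rightarrow> ('p, 'c) atom set \<Rightarrow> ('p, 'c) rule set" where
  "reduct Q I = {Rule (Pos |`| pos (head \<rho>)) (Pos |`| pos (body \<rho>)) | \<rho>.
     \<rho> \<in> Q \<and> sat_lits I (Naf |`| neg (body \<rho>)) \<and> sat_lits I (Pos |`| neg (head \<rho>))}"

definition answer_set :: "('p, 'c) rule set \<Rightarrow> ('p, 'c) atom set \<Rightarrow> bool" where
  "answer_set Q I \<longleftrightarrow> minimal_model (reduct Q I) I"

definition open_answer_set ::
  "('p, 'c trm) rule fset \<Rightarrow> 'c set \<Rightarrow> ('p, 'c) atom set \<Rightarrow> bool" where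
  "open_answer_set P U M \<longleftrightarrow> universe P U \<and>
     M \<subseteq> {Pred q cs | q cs. (q, length cs) \<in> prog_preds P \<and> set cs \<subseteq> U} \<and>
     answer_set (ground P U) M"

definition p_program :: "'p \<Rightarrow> nat \<Rightarrow> ('p, 'c trm) rule fset \<Rightarrow> bool" where
  "p_program p n P \<longleftrightarrow> is_program P \<and> prog_preds P \<subseteq> {(p, n)}"


section \<open>Fixed point logic\<close>

text \<open>\<open>PVar W ts\<close> is a predicate variable applied to terms, and \<open>Lfp W xs \<psi> ts\<close> is
  \<open>[LFP W xs. \<psi>](ts)\<close>. Conjunctions and disjunctions range over finite sets of formulas, so that
  \<open>Conj {||}\<close> is true and \<open>Disj {||}\<close> is false.\<close>

type_synonym pvar = nat

datatype ('p, 'c) fm =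
  Atom "('p, 'c trm) atom"
| PVar pvar "'c trm list"
| Neg "('p, 'c) fm"
| Conj "('p, 'c) fm fset"
| Disj "('p, 'c) fm fset"
| Imp "('p, 'c) fm" "('p, 'c) fm"
| Iff "('p, 'c) fm" "('p, 'c) fm"
| Forall var "('p, 'c) fm"
| Exists var "('p, 'c) fm"
| Lfp pvar "var list" "('p, 'c) fm" "'c trm list"

lemma size_fm_less [termination_simp]:
  fixes \<phi> :: "('p, 'c) fm"
  assumes "\<phi> |\<in>| \<Phi>"
  shows "size \<phi> < Suc (\<Sum>x\<in>fset \<Phi>. Suc (size x))"
proof -
  have "Suc (size \<phi>) \<le> (\<Sum>x\<in>fset \<Phi>. Suc (size x))"
    using assms by (intro member_le_sum[of _ _ "\<lambda>x. Suc (size x)"]) auto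
  then show ?thesis by simp
qed

definition upds :: "(var \<Rightarrow> 'c) \<Rightarrow> var list \<Rightarrow> 'c list \<Rightarrow> var \<Rightarrow> 'c" where
  "upds \<sigma> xs us = (\<lambda>x. case map_of (zip xs us) x of Some u \<Rightarrow> u | None \<Rightarrow> \<sigma> x)"

text \<open>Truth in the interpretation \<open>(U, N)\<close> under values \<open>\<nu>\<close> of the predicate variables and \<open>\<sigma>\<close> of
  the first-order variables. The constant \<open>lfp\<close> denotes the least fixed point only for monotone
  operators; lemma \<open>mono_lfp_operator\<close> below shows that this covers all formulas of the logic.\<close>

fun sat :: "'c set \<Rightarrow> ('p, 'c) atom set \<Rightarrow> (pvar \<Rightarrow> 'c list set) \<Rightarrow> (var \<Rightarrow> 'c) \<Rightarrow>
    ('p, 'c) fm \<Rightarrow> bool" where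
  "sat U N \<nu> \<sigma> (Atom a) \<longleftrightarrow> sat_atom N (map_atom id (val \<sigma>) a)"
| "sat U N \<nu> \<sigma> (PVar W ts) \<longleftrightarrow> map (val \<sigma>) ts \<in> \<nu> W"
| "sat U N \<nu> \<sigma> (Neg \<phi>) \<longleftrightarrow> \<not> sat U N \<nu> \<sigma> \<phi>"
| "sat U N \<nu> \<sigma> (Conj \<Phi>) \<longleftrightarrow> (\<forall>\<phi> |\<in>| \<Phi>. sat U N \<nu> \<sigma> \<phi>)"
| "sat U N \<nu> \<sigma> (Disj \<Phi>) \<longleftrightarrow> (\<exists>\<phi> |\<in>| \<Phi>. sat U N \<nu> \<sigma> \<phi>)"
| "sat U N \<nu> \<sigma> (Imp \<phi> \<psi>) \<longleftrightarrow> (sat U N \<nu> \<sigma> \<phi> \<longrightarrow> sat U N \<nu> \<sigma> \<psi>)"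
| "sat U N \<nu> \<sigma> (Iff \<phi> \<psi>) \<longleftrightarrow> (sat U N \<nu> \<sigma> \<phi> \<longleftrightarrow> sat U N \<nu> \<sigma> \<psi>)"
| "sat U N \<nu> \<sigma> (Forall x \<phi>) \<longleftrightarrow> (\<forall>u\<in>U. sat U N \<nu> (\<sigma>(x := u)) \<phi>)"
| "sat U N \<nu> \<sigma> (Exists x \<phi>) \<longleftrightarrow> (\<exists>u\<in>U. sat U N \<nu> (\<sigma>(x := u)) \<phi>)"
| "sat U N \<nu> \<sigma> (Lfp W xs \<psi> ts) \<longleftrightarrow>
     map (val \<sigma>) ts \<in> lfp (\<lambda>S. {us. length us = length xs \<and> set us \<subseteq> U \<and>
       sat U N (\<nu>(W := S)) (upds \<sigma> xs us) \<psi>})"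

definition is_model :: "'c set \<Rightarrow> ('p, 'c) atom set \<Rightarrow> ('p, 'c) fm \<Rightarrow> bool" where
  "is_model U N \<phi> \<longleftrightarrow> (\<forall>\<nu> \<sigma>. (\<forall>x. \<sigma> x \<in> U) \<longrightarrow> sat U N \<nu> \<sigma> \<phi>)"

subsection \<open>Well-formed formulas\<close>

text \<open>\<open>occ True \<phi>\<close> and \<open>occ False \<phi>\<close> collect the predicate variables with a free positive or
  negative occurrence in \<open>\<phi>\<close>.\<close>

fun occ :: "bool \<Rightarrow> ('p, 'c) fm \<Rightarrow> pvar set" where
  "occ b (Atom a) = {}"
| "occ b (PVar W ts) = (if b then {W} else {})"
| "occ b (Neg \<phi>) = occ (\<not> b) \<phi>"
| "occ b (Conj \<Phi>) = (\<Union>\<phi>\<in>fset \<Phi>. occ b \<phi>)"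
| "occ b (Disj \<Phi>) = (\<Union>\<phi>\<in>fset \<Phi>. occ b \<phi>)"
| "occ b (Imp \<phi> \<psi>) = occ (\<not> b) \<phi> \<union> occ b \<psi>"
| "occ b (Iff \<phi> \<psi>) = occ True \<phi> \<union> occ False \<phi> \<union> occ True \<psi> \<union> occ False \<psi>"
| "occ b (Forall x \<phi>) = occ b \<phi>"
| "occ b (Exists x \<phi>) = occ b \<phi>"
| "occ b (Lfp W xs \<psi> ts) = occ b \<psi> - {W}"

definition trms_fv :: "'c trm list \<Rightarrow> var set" where
  "trms_fv ts = (\<Union>t\<in>set ts. fset (trm_vars t))"

fun fv :: "('p, 'c) fm \<Rightarrow> var set" where
  "fv (Atom a) = trms_fv (args a)"
| "fv (PVar W ts) = trms_fv ts"
| "fv (Neg \<phi>) = fv \<phi>"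
| "fv (Conj \<Phi>) = (\<Union>\<phi>\<in>fset \<Phi>. fv \<phi>)"
| "fv (Disj \<Phi>) = (\<Union>\<phi>\<in>fset \<Phi>. fv \<phi>)"
| "fv (Imp \<phi> \<psi>) = fv \<phi> \<union> fv \<psi>"
| "fv (Iff \<phi> \<psi>) = fv \<phi> \<union> fv \<psi>"
| "fv (Forall x \<phi>) = fv \<phi> - {x}"
| "fv (Exists x \<phi>) = fv \<phi> - {x}"
| "fv (Lfp W xs \<psi> ts) = (fv \<psi> - set xs) \<union> trms_fv ts"

text \<open>\<open>ar\<close> gives the arities of the free predicate variables.\<close>

fun wf_fm :: "(pvar \<Rightarrow> nat) \<Rightarrow> ('p, 'c) fm \<Rightarrow> bool" where
  "wf_fm ar (Atom a) \<longleftrightarrow> True"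
| "wf_fm ar (PVar W ts) \<longleftrightarrow> length ts = ar W"
| "wf_fm ar (Neg \<phi>) \<longleftrightarrow> wf_fm ar \<phi>"
| "wf_fm ar (Conj \<Phi>) \<longleftrightarrow> (\<forall>\<phi> |\<in>| \<Phi>. wf_fm ar \<phi>)"
| "wf_fm ar (Disj \<Phi>) \<longleftrightarrow> (\<forall>\<phi> |\<in>| \<Phi>. wf_fm ar \<phi>)"
| "wf_fm ar (Imp \<phi> \<psi>) \<longleftrightarrow> wf_fm ar \<phi> \<and> wf_fm ar \<psi>"
| "wf_fm ar (Iff \<phi> \<psi>) \<longleftrightarrow> wf_fm ar \<phi> \<and> wf_fm ar \<psi>"
| "wf_fm ar (Forall x \<phi>) \<longleftrightarrow> wf_fm ar \<phi>"
| "wf_fm ar (Exists x \<phi>) \<longleftrightarrow> wf_fm ar \<phi>"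
| "wf_fm ar (Lfp W xs \<psi> ts) \<longleftrightarrow> wf_fm (ar(W := length xs)) \<psi> \<and> W \<notin> occ False \<psi> \<and>
     fv \<psi> \<subseteq> set xs \<and> distinct xs \<and> length ts = length xs"

lemma sat_mono:
  assumes "\<And>V. V \<in> occ True \<phi> \<Longrightarrow> \<nu> V \<subseteq> \<nu>' V" "\<And>V. V \<in> occ False \<phi> \<Longrightarrow> \<nu>' V \<subseteq> \<nu> V"
    and "sat U N \<nu> \<sigma> \<phi>"
  shows "sat U N \<nu>' \<sigma> \<phi>"
  using assms
proof (induction \<phi> arbitrary: \<nu> \<nu>' \<sigma>)
  case (Atom a)
  then show ?case by simp
next
  case (PVar W ts)
  then show ?case by auto
next
  case (Neg \<phi>)
  have "sat U N \<nu> \<sigma> \<phi>" if "sat U N \<nu>' \<sigma> \<phi>"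
    by (rule Neg.IH[OF _ _ that]) (use Neg.prems(1,2) in auto)
  then show ?case using Neg.prems(3) by auto
next
  case (Conj \<Phi>)
  have "sat U N \<nu>' \<sigma> \<phi>" if "\<phi> |\<in>| \<Phi>" for \<phi>
    by (rule Conj.IH[OF that, of \<nu>]) (use that Conj.prems in auto)
  then show ?case by simp
next
  case (Disj \<Phi>)
  then obtain \<phi> where \<phi>: "\<phi> |\<in>| \<Phi>" "sat U N \<nu> \<sigma> \<phi>" by auto
  have "sat U N \<nu>' \<sigma> \<phi>"
    by (rule Disj.IH[OF \<phi>(1) _ _ \<phi>(2)]) (use \<phi>(1) Disj.prems(1,2) in auto)
  then show ?case using \<phi>(1) by auto
next
  case (Imp \<phi> \<psi>)
  have "sat U N \<nu> \<sigma> \<phi>" if "sat U N \<nu>' \<sigma> \<phi>"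
    by (rule Imp.IH(1)[OF _ _ that]) (use Imp.prems(1,2) in auto)
  moreover have "sat U N \<nu>' \<sigma> \<psi>" if "sat U N \<nu> \<sigma> \<psi>"
    by (rule Imp.IH(2)[OF _ _ that]) (use Imp.prems(1,2) in auto)
  ultimately show ?case using Imp.prems(3) by auto
next
  case (Iff \<phi> \<psi>)
  have "sat U N \<mu>' \<sigma> \<phi>" if "sat U N \<mu> \<sigma> \<phi>" "(\<mu>, \<mu>') \<in> {(\<nu>, \<nu>'), (\<nu>', \<nu>)}" for \<mu> \<mu>'
    by (rule Iff.IH(1)[OF _ _ that(1)]) (use that(2) Iff.prems(1,2) in auto)
  moreover have "sat U N \<mu>' \<sigma> \<psi>"
    if "sat U N \<mu> \<sigma> \<psi>" "(\<mu>, \<mu>') \<in> {(\<nu>, \<nu>'), (\<nu>', \<nu>)}" for \<mu> \<mu>'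
    by (rule Iff.IH(2)[OF _ _ that(1)]) (use that(2) Iff.prems(1,2) in auto)
  ultimately show ?case using Iff.prems(3) by simp blast
next
  case (Forall x \<phi>)
  have "sat U N \<nu>' (\<sigma>(x := u)) \<phi>" if "u \<in> U" for u
  proof (rule Forall.IH)
    show "sat U N \<nu> (\<sigma>(x := u)) \<phi>" using that Forall.prems(3) by simp
  qed (use Forall.prems(1,2) in auto)
  then show ?case by simp
next
  case (Exists x \<phi>)
  then obtain u where u: "u \<in> U" "sat U N \<nu> (\<sigma>(x := u)) \<phi>" by auto
  have "sat U N \<nu>' (\<sigma>(x := u)) \<phi>"
    by (rule Exists.IH[OF _ _ u(2)]) (use Exists.prems(1,2) in auto)
  then show ?case using u(1) by auto
next
  case (Lfp W xs \<psi> ts)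
  have "sat U N (\<nu>'(W := S)) \<tau> \<psi>" if "sat U N (\<nu>(W := S)) \<tau> \<psi>" for S \<tau>
    by (rule Lfp.IH[OF _ _ that]) (use Lfp.prems(1,2) in auto)
  then have "lfp (\<lambda>S. {us. length us = length xs \<and> set us \<subseteq> U \<and>
       sat U N (\<nu>(W := S)) (upds \<sigma> xs us) \<psi>}) \<subseteq>
     lfp (\<lambda>S. {us. length us = length xs \<and> set us \<subseteq> U \<and>
       sat U N (\<nu>'(W := S)) (upds \<sigma> xs us) \<psi>})"
    by (intro lfp_mono) auto
  then show ?case using Lfp.prems(3) by auto
qed

lemma mono_lfp_operator:
  assumes "wf_fm ar (Lfp W xs \<psi> ts)"
  shows "mono (\<lambda>S. {us. length us = length xs \<and> set us \<subseteq> U \<and>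
    sat U N (\<nu>(W := S)) (upds \<sigma> xs us) \<psi>})"
proof (rule monoI)
  fix S T :: "'b list set"
  assume "S \<subseteq> T"
  have "sat U N (\<nu>(W := T)) \<tau> \<psi>" if "sat U N (\<nu>(W := S)) \<tau> \<psi>" for \<tau>
    by (rule sat_mono[OF _ _ that]) (use assms \<open>S \<subseteq> T\<close> in \<open>auto split: if_splits\<close>)
  then show "{us. length us = length xs \<and> set us \<subseteq> U \<and> sat U N (\<nu>(W := S)) (upds \<sigma> xs us) \<psi>} \<subseteq>
      {us. length us = length xs \<and> set us \<subseteq> U \<and> sat U N (\<nu>(W := T)) (upds \<sigma> xs us) \<psi>}"
    by auto
qed


section \<open>The completion\<close>

primrec lit_fm :: "('p, 'c trm) literal \<Rightarrow> ('p, 'c) fm" where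
  "lit_fm (Pos a) = Atom a"
| "lit_fm (Naf a) = Neg (Atom a)"

definition foralls :: "var list \<Rightarrow> ('p, 'c) fm \<Rightarrow> ('p, 'c) fm" where
  "foralls xs \<phi> = foldr Forall xs \<phi>"

definition exists :: "var list \<Rightarrow> ('p, 'c) fm \<Rightarrow> ('p, 'c) fm" where
  "exists xs \<phi> = foldr Exists xs \<phi>"

text \<open>The tuple \<open>Y\<close> of the variables of a rule, in increasing order.\<close>

definition rule_vars :: "('p, 'c trm) rule \<Rightarrow> var list" where
  "rule_vars r = sorted_list_of_fset (vars r)"

text \<open>The predicate symbol \<open>name r\<close> is the name of the rule \<open>r\<close>.\<close>

definition name_fm ::
  "(('p, 'c trm) rule \<Rightarrow> 'p) \<Rightarrow> ('p, 'c trm) rule \<Rightarrow> ('p, 'c) fm" where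
  "name_fm name r = Atom (Pred (name r) (map Var (rule_vars r)))"

definition sat_fm :: "('p, 'c trm) rule \<Rightarrow> ('p, 'c) fm" where
  "sat_fm r = foralls (rule_vars r) (Imp (Conj (lit_fm |`| body r)) (Disj (lit_fm |`| head r)))"

definition gl_fm ::
  "(('p, 'c trm) rule \<Rightarrow> 'p) \<Rightarrow> ('p, 'c trm) rule \<Rightarrow> ('p, 'c) fm" where
  "gl_fm name r = foralls (rule_vars r) (Iff (name_fm name r)
     (Conj (Atom |`| neg (head r) |\<union>| (\<lambda>a. Neg (Atom a)) |`| neg (body r))))"

primrec repl :: "'p \<Rightarrow> pvar \<Rightarrow> ('p, 'c trm) atom \<Rightarrow> ('p, 'c) fm" where
  "repl p W (Pred q ts) = (if q = p then PVar W ts else Atom (Pred q ts))"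
| "repl p W (Eq s t) = Atom (Eq s t)"

text \<open>\<open>E(r)\<close>, where \<open>ts\<close> are the arguments of the atom of \<open>p\<close> in the head of \<open>r\<close>.\<close>

definition E_fm ::
  "'p \<Rightarrow> (('p, 'c trm) rule \<Rightarrow> 'p) \<Rightarrow> pvar \<Rightarrow> var list \<Rightarrow> ('p, 'c trm) rule \<Rightarrow> 'c trm list \<Rightarrow>
    ('p, 'c) fm" where
  "E_fm p name W xs r ts = exists (rule_vars r) (Conj (
     fset_of_list (map2 (\<lambda>x t. Atom (Eq (Var x) t)) xs ts) |\<union>|
     repl p W |`| pos (body r) |\<union>|
     {|name_fm name r|}))"

definition phi_fm ::
  "'p \<Rightarrow> (('p, 'c trm) rule \<Rightarrow> 'p) \<Rightarrow> pvar \<Rightarrow> var list \<Rightarrow> ('p, 'c trm) rule fset \<Rightarrow>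
    ('p, 'c) fm" where
  "phi_fm p name W xs P = Disj (finsert (PVar W (map Var xs))
     (ffUnion ((\<lambda>r. (\<lambda>a. E_fm p name W xs r (args a)) |`|
       ffilter (\<lambda>a. \<exists>ts. a = Pred p ts) (pos (head r))) |`| P)))"

definition fp_fm ::
  "'p \<Rightarrow> (('p, 'c trm) rule \<Rightarrow> 'p) \<Rightarrow> pvar \<Rightarrow> var list \<Rightarrow> ('p, 'c trm) rule fset \<Rightarrow>
    ('p, 'c) fm" where
  "fp_fm p name W xs P = foralls xs (Imp (Atom (Pred p (map Var xs)))
     (Lfp W xs (phi_fm p name W xs P) (map Var xs)))"

text \<open>Parameters: \<open>name\<close> is to be injective on \<open>P\<close> with values different from \<open>p\<close>, and \<open>xs\<close> is the
  tuple of new variables, distinct and not occurring in \<open>P\<close>, with the arity of \<open>p\<close> as its length.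
  \<open>Conj {||}\<close> is the formula \<open>true\<close>; the choice of the variable \<open>0\<close> quantified in front of it is
  immaterial.\<close>

definition completion ::
  "'p \<Rightarrow> (('p, 'c trm) rule \<Rightarrow> 'p) \<Rightarrow> pvar \<Rightarrow> var list \<Rightarrow> ('p, 'c trm) rule fset \<Rightarrow>
    ('p, 'c) fm fset" where
  "completion p name W xs P =
     ffUnion ((\<lambda>a. (\<lambda>b. Neg (Atom (Eq (Const a) (Const b)))) |`|
       ffilter (\<lambda>b. a \<noteq> b) (prog_consts P)) |`| prog_consts P) |\<union>|
     {|Exists 0 (Conj {||})|} |\<union>|
     sat_fm |`| P |\<union>|
     gl_fm name |`| P |\<union>|
     {|fp_fm p name W xs P|}"

lemma fv_foralls: "fv (foralls xs \<phi>) = fv \<phi> - set xs"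
  by (induction xs) (auto simp: foralls_def)

lemma fv_exists: "fv (exists xs \<phi>) = fv \<phi> - set xs"
  by (induction xs) (auto simp: exists_def)

lemma wf_foralls: "wf_fm ar (foralls xs \<phi>) = wf_fm ar \<phi>"
  by (induction xs) (auto simp: foralls_def)

lemma wf_exists: "wf_fm ar (exists xs \<phi>) = wf_fm ar \<phi>"
  by (induction xs) (auto simp: exists_def)

lemma occ_exists: "occ b (exists xs \<phi>) = occ b \<phi>"
  by (induction xs) (auto simp: exists_def)

lemma mem_pos: "a |\<in>| pos L \<longleftrightarrow> Pos a |\<in>| L"
proof
  assume "a |\<in>| pos L"
  then obtain l where "l |\<in>| L" "is_Pos l" "a = atm l" by (auto simp: pos_def)
  then show "Pos a |\<in>| L" by (cases l) auto
qed (force simp: pos_def image_iff)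

lemma mem_neg: "a |\<in>| neg L \<longleftrightarrow> Naf a |\<in>| L"
proof
  assume "a |\<in>| neg L"
  then obtain l where "l |\<in>| L" "\<not> is_Pos l" "a = atm l" by (auto simp: neg_def)
  then show "Naf a |\<in>| L" by (cases l) auto
qed (force simp: neg_def image_iff)

lemma set_rule_vars: "set (rule_vars r) = fset (vars r)"
  by (simp add: rule_vars_def)

lemma trms_fv_map_Var: "trms_fv (map Var xs) = set xs"
  by (auto simp: trms_fv_def)

lemma trms_fv_args:
  assumes "l |\<in>| head r |\<union>| body r"
  shows "trms_fv (args (atm l)) \<subseteq> fset (vars r)"
  using assms unfolding trms_fv_def vars_def trms_def atoms_def
  by (auto simp: ffUnion.rep_eq fset_of_list.rep_eq)

lemma lit_fm_props:
  "fv (lit_fm l) = trms_fv (args (atm l))" "wf_fm ar (lit_fm l)"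
  by (cases l; simp)+

lemma repl_props:
  "fv (repl p W a) = trms_fv (args a)" "occ False (repl p W a) = {}"
  by (cases a; simp)+

lemma E_fm_props:
  assumes "p_program p n P" "r |\<in>| P" "Pred p ts |\<in>| pos (head r)"
  shows "fv (E_fm p name W xs r ts) \<subseteq> set xs" "occ False (E_fm p name W xs r ts) = {}"
    "ar W = n \<Longrightarrow> wf_fm ar (E_fm p name W xs r ts)"
proof -
  let ?eqs = "fset_of_list (map2 (\<lambda>x t. Atom (Eq (Var x) t)) xs ts) :: ('a, 'b) fm fset"
  have h: "trms_fv ts \<subseteq> fset (vars r)"
    using trms_fv_args[of "Pos (Pred p ts)" r] assms(3) by (simp add: mem_pos)
  have b: "trms_fv (args a) \<subseteq> fset (vars r)" if "a |\<in>| pos (body r)" for a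
    using trms_fv_args[of "Pos a" r] that by (simp add: mem_pos)
  have eqs: "\<exists>x t. \<phi> = Atom (Eq (Var x) t) \<and> x \<in> set xs \<and> t \<in> set ts" if "\<phi> |\<in>| ?eqs" for \<phi>
    using that by (auto simp: fset_of_list.rep_eq dest: set_zip_leftD set_zip_rightD)
  have "fv \<phi> \<subseteq> set xs \<union> fset (vars r)" if "\<phi> |\<in>| ?eqs" for \<phi>
    using eqs[OF that] h by (fastforce simp: trms_fv_def)
  then show "fv (E_fm p name W xs r ts) \<subseteq> set xs"
    using b by (fastforce simp: E_fm_def fv_exists set_rule_vars name_fm_def repl_props trms_fv_map_Var)
  have "occ False \<phi> = {}" if "\<phi> |\<in>| ?eqs" for \<phi>
    using eqs[OF that] by auto
  then show "occ False (E_fm p name W xs r ts) = {}"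
    by (auto simp: E_fm_def occ_exists name_fm_def repl_props)
  have "wf_fm ar \<phi>" if "\<phi> |\<in>| ?eqs" for \<phi>
    using eqs[OF that] by auto
  moreover have "wf_fm ar (repl p W a)" if "ar W = n" "a |\<in>| pos (body r)" for a
  proof (cases a)
    case (Pred q ts)
    then have "Pred q ts |\<in>| atoms r" using that(2) by (force simp: atoms_def mem_pos image_iff)
    then have "(q, length ts) \<in> prog_preds P" using assms(2) by (auto simp: prog_preds_def)
    then show ?thesis using Pred assms(1) that(1) by (auto simp: p_program_def)
  qed simp
  ultimately show "wf_fm ar (E_fm p name W xs r ts)" if "ar W = n"
    using that by (auto simp: E_fm_def wf_exists name_fm_def ball_Un)
qed

lemma completion_sentences:
  assumes "p_program p n P" "distinct xs" "length xs = n" "\<phi> |\<in>| completion p name W xs P"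
  shows "wf_fm ar \<phi>" "fv \<phi> = {}"
proof -
  let ?D = "ffUnion ((\<lambda>r. (\<lambda>a. E_fm p name W xs r (args a)) |`|
       ffilter (\<lambda>a. \<exists>ts. a = Pred p ts) (pos (head r))) |`| P)"
  have D: "\<exists>r ts. r |\<in>| P \<and> Pred p ts |\<in>| pos (head r) \<and> \<psi> = E_fm p name W xs r ts"
    if "\<psi> |\<in>| ?D" for \<psi>
    using that by (force simp: ffUnion.rep_eq)
  have "fv \<psi> \<subseteq> set xs \<and> occ False \<psi> = {} \<and> wf_fm (ar(W := n)) \<psi>"
    if mem: "\<psi> |\<in>| ?D" for \<psi>
  proof -
    obtain r ts where r: "r |\<in>| P" "Pred p ts |\<in>| pos (head r)" and \<psi>: "\<psi> = E_fm p name W xs r ts"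
      using D[OF mem] by blast
    show ?thesis unfolding \<psi> by (intro conjI E_fm_props[OF assms(1) r]) simp
  qed
  then have 1: "fv (phi_fm p name W xs P) \<subseteq> set xs \<and> occ False (phi_fm p name W xs P) = {} \<and>
      wf_fm (ar(W := n)) (phi_fm p name W xs P)"
    using assms(3) unfolding phi_fm_def by (simp add: trms_fv_map_Var) blast
  have fp: "wf_fm ar (fp_fm p name W xs P)" "fv (fp_fm p name W xs P) = {}"
    using 1 assms(2,3) by (auto simp: fp_fm_def wf_foralls fv_foralls trms_fv_map_Var)
  have sat: "wf_fm ar (sat_fm r)" "fv (sat_fm r) = {}" for r :: "('a, 'b trm) rule"
    using trms_fv_args[of _ r]
    by (auto simp: sat_fm_def wf_foralls fv_foralls lit_fm_props set_rule_vars)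
  have gl: "wf_fm ar (gl_fm name r)" "fv (gl_fm name r) = {}" for r
  proof -
    show "wf_fm ar (gl_fm name r)" by (auto simp: gl_fm_def wf_foralls name_fm_def)
    have "trms_fv (args a) \<subseteq> fset (vars r)" if "a |\<in>| neg (head r) |\<union>| neg (body r)" for a
      using trms_fv_args[of "Naf a" r] that by (auto simp: mem_neg)
    then show "fv (gl_fm name r) = {}"
      by (fastforce simp: gl_fm_def fv_foralls name_fm_def set_rule_vars trms_fv_map_Var)
  qed
  consider a b where "\<phi> = Neg (Atom (Eq (Const a) (Const b)))" | "\<phi> = Exists 0 (Conj {||})"
    | r where "\<phi> = sat_fm r" | r where "\<phi> = gl_fm name r" | "\<phi> = fp_fm p name W xs P"
    using assms(4) unfolding completion_def by (auto simp: ffUnion.rep_eq)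
  then have "wf_fm ar \<phi> \<and> fv \<phi> = {}"
    by cases (simp_all add: fp sat gl trms_fv_def)
  then show "wf_fm ar \<phi>" "fv \<phi> = {}" by simp_all
qed

text \<open>The set \<open>R\<close>; the tuple \<open>y\<close> substituted for the variables \<open>Y\<close> of \<open>r\<close> is
  \<open>map \<sigma> (rule_vars r)\<close>.\<close>

definition name_atoms ::
  "(('p, 'c trm) rule \<Rightarrow> 'p) \<Rightarrow> ('p, 'c trm) rule fset \<Rightarrow> 'c set \<Rightarrow> ('p, 'c) atom set \<Rightarrow>
    ('p, 'c) atom set" where
  "name_atoms name P U M = {Pred (name r) (map \<sigma> (rule_vars r)) | r \<sigma>.
     r |\<in>| P \<and> (\<forall>x |\<in>| vars r. \<sigma> x \<in> U) \<and>
     sat_lits M (Pos |`| neg (head (ground_rule \<sigma> r)) |\<union>|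
                 Naf |`| neg (body (ground_rule \<sigma> r)))}"

end

theory Submission
  imports Defs
begin

text \<open>An answer set of a program whose rules have at most one positive head atom is a model all of
  whose atoms are derivable from the reduct, i.e. lie in the least fixed point of the immediate
  consequence operator. Constraints do not disturb minimality, as they are inherited by subsets of a
  model. For the ground rules of a \<open>p\<close>-program this operator acts on tuples
  exactly as the formula \<open>\<phi>(W, X)\<close> does once the name predicates hold where \<open>R\<close> says.\<close>

subsection \<open>Answer sets as least fixed points\<close>

text \<open>The condition under which the GL-reduct by \<open>I\<close> keeps a rule. It uses the
  same union of literals as \<open>name_atoms\<close>, so membership in \<open>R\<close> unfolds to
  it.\<close>

definition applicable :: "('p, 'c) atom set \<Rightarrow> ('p, 'c) rule \<Rightarrow> bool" where
  "applicable I \<rho> \<longleftrightarrow> sat_lits I (Pos |`| neg (head \<rho>) |\<union>| Naf |`| neg (body \<rho>))"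

definition sat_pos_body :: "('p, 'c) atom set \<Rightarrow> ('p, 'c) rule \<Rightarrow> bool" where
  "sat_pos_body I \<rho> \<longleftrightarrow> (\<forall>a |\<in>| pos (body \<rho>). sat_atom I a)"

text \<open>The immediate consequence operator of the reduct of \<open>Q\<close> by
  \<open>I\<close>. The fixed set \<open>I\<close> decides the negative literals, and only positive
  bodies are evaluated in the varying \<open>S\<close>; this makes the operator monotone.
  Constraints contribute nothing.\<close>

definition consequences ::
  "('p, 'c) rule set \<Rightarrow> ('p, 'c) atom set \<Rightarrow> ('p, 'c) atom set \<Rightarrow> ('p, 'c) atom set" where
  "consequences Q I S =
     {a. \<exists>\<rho>\<in>Q. applicable I \<rho> \<and> sat_pos_body S \<rho> \<and> a |\<in>| pos (head \<rho>)}"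

lemma ball_lits:
  "(\<forall>l |\<in>| L. A l) \<longleftrightarrow> (\<forall>a |\<in>| pos L. A (Pos a)) \<and> (\<forall>a |\<in>| neg L. A (Naf a))"
  by (metis literal.exhaust mem_neg mem_pos)

lemma bex_lits:
  "(\<exists>l |\<in>| L. A l) \<longleftrightarrow> (\<exists>a |\<in>| pos L. A (Pos a)) \<or> (\<exists>a |\<in>| neg L. A (Naf a))"
  by (metis literal.exhaust mem_neg mem_pos)

lemma sat_atom_mono: "sat_atom I a \<Longrightarrow> I \<subseteq> J \<Longrightarrow> sat_atom J a"
  by (cases a) auto

lemma sat_pos_body_mono: "sat_pos_body I \<rho> \<Longrightarrow> I \<subseteq> J \<Longrightarrow> sat_pos_body J \<rho>"
  by (auto simp: sat_pos_body_def intro: sat_atom_mono)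

lemma mono_consequences: "mono (consequences Q I)"
  by (rule monoI) (auto simp: consequences_def dest: sat_pos_body_mono)

lemma applicable_iff:
  "applicable I \<rho> \<longleftrightarrow>
     (\<forall>a |\<in>| neg (head \<rho>). sat_atom I a) \<and> (\<forall>a |\<in>| neg (body \<rho>). \<not> sat_atom I a)"
  by (simp add: applicable_def sat_lits_def ball_Un)

text \<open>If \<open>\<rho>\<close> is not applicable, a naf-literal of its body fails or a
  naf-literal of its head holds, and the rule is satisfied in either case.\<close>

lemma sat_rule_iff:
  "sat_rule I \<rho> \<longleftrightarrow>
     (applicable I \<rho> \<longrightarrow> sat_pos_body I \<rho> \<longrightarrow> (\<exists>a |\<in>| pos (head \<rho>). sat_atom I a))"
  unfolding sat_rule_def sat_lits_def ball_lits[of _ "sat_lit I"] bex_lits[of _ "sat_lit I"]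
    applicable_iff sat_pos_body_def
  by auto

text \<open>Removes the reduct: \<open>I\<close> evaluates the negative parts and \<open>J\<close>
  the positive ones. For \<open>J = I\<close> the condition on rules is that of
  \<open>sat_rule_iff\<close>, so being a model of the own reduct amounts to satisfying
  \<open>Q\<close>.\<close>

lemma ground_model_reduct:
  "ground_model (reduct Q I) J \<longleftrightarrow> (\<forall>a\<in>J. regular a) \<and>
     (\<forall>\<rho>\<in>Q. applicable I \<rho> \<longrightarrow> sat_pos_body J \<rho> \<longrightarrow> (\<exists>a |\<in>| pos (head \<rho>). sat_atom J a))"
proof -
  have "sat_rule J (Rule (Pos |`| A) (Pos |`| B)) \<longleftrightarrow>
      ((\<forall>a |\<in>| B. sat_atom J a) \<longrightarrow> (\<exists>a |\<in>| A. sat_atom J a))" for A B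
    by (simp add: sat_rule_def sat_lits_def)
  then show ?thesis
    unfolding ground_model_def reduct_def sat_pos_body_def applicable_iff
    by (simp add: sat_lits_def) blast
qed

lemma sat_atom_regular: "regular a \<Longrightarrow> sat_atom I a \<longleftrightarrow> a \<in> I"
  by (cases a) auto

lemma is_rule_head_unique:
  assumes "is_rule r" "a |\<in>| pos (head r)" "b |\<in>| pos (head r)"
  shows "a = b"
  using assms card_le_Suc0_iff_eq[of "fset (pos (head r))"]
  by (auto simp: is_rule_def fcard.rep_eq)

lemma is_rule_regular: "is_rule r \<Longrightarrow> a |\<in>| pos (head r) \<Longrightarrow> regular a"
  by (simp add: is_rule_def)

text \<open>Every model of the reduct is closed under the operator and so contains its least fixed
  point. If \<open>I\<close> is a model, the least fixed point is itself a model inside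
  \<open>I\<close>. Hence \<open>I\<close> is minimal exactly when it does not exceed the least
  fixed point.\<close>

lemma answer_set_iff_lfp:
  assumes rule: "\<And>\<rho>. \<rho> \<in> Q \<Longrightarrow> is_rule \<rho>" and reg: "\<forall>a\<in>I. regular a"
  shows "answer_set Q I \<longleftrightarrow> (\<forall>\<rho>\<in>Q. sat_rule I \<rho>) \<and> I \<subseteq> lfp (consequences Q I)"
proof -
  let ?L = "lfp (consequences Q I)"
  have closed: "consequences Q I J \<subseteq> J" if J: "ground_model (reduct Q I) J" for J
  proof
    fix a assume "a \<in> consequences Q I J"
    then obtain \<rho> where \<rho>: "\<rho> \<in> Q" "applicable I \<rho>" "sat_pos_body J \<rho>" "a |\<in>| pos (head \<rho>)"
      by (auto simp: consequences_def)
    then obtain b where b: "b |\<in>| pos (head \<rho>)" "sat_atom J b"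
      using J by (auto simp: ground_model_reduct)
    \<comment> \<open>The head has at most one positive atom, so \<open>b\<close> is
      \<open>a\<close>; that atom is regular, so satisfaction is membership.\<close>
    then show "a \<in> J"
      using \<rho> rule by (metis is_rule_head_unique is_rule_regular sat_atom_regular)
  qed
  have least: "?L \<subseteq> J" if "ground_model (reduct Q I) J" for J
    by (rule lfp_lowerbound) (rule closed[OF that])
  have model: "ground_model (reduct Q I) I \<longleftrightarrow> (\<forall>\<rho>\<in>Q. sat_rule I \<rho>)"
    using reg by (simp add: ground_model_reduct sat_rule_iff)
  have "ground_model (reduct Q I) ?L \<and> ?L \<subseteq> I" if I: "ground_model (reduct Q I) I"
  proof -
    have sub: "?L \<subseteq> I" by (rule least[OF I])
    have "\<exists>a |\<in>| pos (head \<rho>). sat_atom ?L a"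
      if \<rho>: "\<rho> \<in> Q" "applicable I \<rho>" "sat_pos_body ?L \<rho>" for \<rho>
    proof -
      \<comment> \<open>A constraint cannot fire here: its positive body would hold in the larger
        set \<open>I\<close> too, and \<open>I\<close> is a model of the reduct. So the head
        contains a positive atom.\<close>
      obtain a where a: "a |\<in>| pos (head \<rho>)"
        using I \<rho>(1,2) sat_pos_body_mono[OF \<rho>(3) sub] by (auto simp: ground_model_reduct)
      then have "a \<in> consequences Q I ?L" using \<rho> by (auto simp: consequences_def)
      then have "a \<in> ?L" using lfp_unfold[OF mono_consequences, of Q I] by simp
      then show ?thesis using a is_rule_regular[OF rule[OF \<rho>(1)] a] sat_atom_regular by blast
    qed
    then show ?thesis using sub reg by (auto simp: ground_model_reduct)
  qed
  then show ?thesis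
    unfolding answer_set_def minimal_model_def model[symmetric]
    using least by blast
qed
subsection \<open>Grounding\<close>

lemma map_rule_sel:
  "head (map_rule f g r) = map_literal f g |`| head r"
  "body (map_rule f g r) = map_literal f g |`| body r"
  by (cases r; simp)+

lemma pos_map: "pos (map_literal f g |`| L) = map_atom f g |`| pos L"
proof (rule fset_eqI)
  fix b
  have "b |\<in>| pos (map_literal f g |`| L) \<longleftrightarrow> (\<exists>l |\<in>| L. Pos b = map_literal f g l)"
    by (auto simp: mem_pos)
  also have "\<dots> \<longleftrightarrow> b |\<in>| map_atom f g |`| pos L"
    by (subst bex_lits) auto
  finally show "b |\<in>| pos (map_literal f g |`| L) \<longleftrightarrow> b |\<in>| map_atom f g |`| pos L" .
qed

lemma neg_map: "neg (map_literal f g |`| L) = map_atom f g |`| neg L"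
proof (rule fset_eqI)
  fix b
  have "b |\<in>| neg (map_literal f g |`| L) \<longleftrightarrow> (\<exists>l |\<in>| L. Naf b = map_literal f g l)"
    by (auto simp: mem_neg)
  also have "\<dots> \<longleftrightarrow> b |\<in>| map_atom f g |`| neg L"
    by (subst bex_lits) auto
  finally show "b |\<in>| neg (map_literal f g |`| L) \<longleftrightarrow> b |\<in>| map_atom f g |`| neg L" .
qed

text \<open>Substitution may merge atoms but never splits one, so the bound on positive head atoms
  survives.\<close>

lemma is_rule_ground:
  assumes "is_rule r"
  shows "is_rule (map_rule f g r)"
proof -
  have "fcard (map_atom f g |`| pos (head r)) \<le> fcard (pos (head r))"
    by (simp add: fcard.rep_eq card_image_le)
  moreover have "regular (map_atom f g a) = regular a" for a by (cases a) auto
  ultimately show ?thesis using assms by (auto simp: is_rule_def map_rule_sel pos_map)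
qed

lemma val_cong: "(\<And>x. x |\<in>| trm_vars t \<Longrightarrow> \<sigma> x = \<tau> x) \<Longrightarrow> val \<sigma> t = val \<tau> t"
  by (cases t) auto

lemma ground_rule_cong:
  assumes "\<And>x. x |\<in>| vars r \<Longrightarrow> \<sigma> x = \<tau> x"
  shows "ground_rule \<sigma> r = ground_rule \<tau> r"
proof -
  have "map_literal id (val \<sigma>) l = map_literal id (val \<tau>) l" if "l |\<in>| head r |\<union>| body r" for l
  proof -
    have "val \<sigma> t = val \<tau> t" if "t \<in> set (args (atm l))" for t
      using trms_fv_args[OF \<open>l |\<in>| head r |\<union>| body r\<close>] assms that
      by (intro val_cong) (force simp: trms_fv_def)
    then show ?thesis by (cases l; cases "atm l") auto
  qed
  then show ?thesis by (cases r) (auto intro!: fimage_cong)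
qed

text \<open>\<open>ground\<close> constrains a substitution only on the variables of the rule,
  whereas \<open>is_model\<close> ranges over assignments with all values in \<open>U\<close>. As
  \<open>U\<close> is non-empty, the other variables can be sent to any fixed element.\<close>

lemma total_substitution:
  assumes "universe P U" "\<forall>x |\<in>| vars r. \<sigma> x \<in> U"
  obtains \<tau> where "\<forall>x. \<tau> x \<in> U" "ground_rule \<tau> r = ground_rule \<sigma> r"
proof -
  obtain u where u: "u \<in> U" using assms(1) by (auto simp: universe_def)
  let ?\<tau> = "\<lambda>x. if x |\<in>| vars r then \<sigma> x else u"
  have "ground_rule ?\<tau> r = ground_rule \<sigma> r" by (rule ground_rule_cong) simp
  then show thesis using that[of ?\<tau>] u assms(2) by simp
qed

lemma ground_alt:
  assumes "universe P U"
  shows "ground P U = {ground_rule \<sigma> r | r \<sigma>. r |\<in>| P \<and> (\<forall>x. \<sigma> x \<in> U)}"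
proof
  show "ground P U \<subseteq> {ground_rule \<sigma> r | r \<sigma>. r |\<in>| P \<and> (\<forall>x. \<sigma> x \<in> U)}"
  proof
    fix \<rho> assume "\<rho> \<in> ground P U"
    then obtain r \<sigma> where r: "\<rho> = ground_rule \<sigma> r" "r |\<in>| P" "\<forall>x |\<in>| vars r. \<sigma> x \<in> U"
      by (auto simp: ground_def)
    obtain \<tau> where "\<forall>x. \<tau> x \<in> U" "ground_rule \<tau> r = ground_rule \<sigma> r"
      by (rule total_substitution[OF assms r(3)])
    moreover from this have "\<rho> = ground_rule \<tau> r" using r(1) by simp
    ultimately show "\<rho> \<in> {ground_rule \<sigma> r | r \<sigma>. r |\<in>| P \<and> (\<forall>x. \<sigma> x \<in> U)}"
      using r(2) by blast
  qed
qed (auto simp: ground_def)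

lemma val_in_universe:
  assumes "universe P U" "r |\<in>| P" "a |\<in>| atoms r" "t \<in> set (args a)" "\<forall>x. \<sigma> x \<in> U"
  shows "val \<sigma> t \<in> U"
proof (cases t)
  case (Const c)
  have "t |\<in>| trms r" using assms(3,4) by (force simp: trms_def ffUnion.rep_eq fset_of_list.rep_eq)
  then have "c |\<in>| prog_consts P"
    using assms(2) Const by (force simp: prog_consts_def ffUnion.rep_eq)
  then show ?thesis using assms(1) Const by (auto simp: universe_def)
qed (simp add: assms(5))

subsection \<open>Quantifier blocks\<close>

lemma sat_foralls:
  "sat U N \<nu> \<sigma> (foralls ys \<phi>) \<longleftrightarrow>
     (\<forall>\<tau>. (\<forall>y\<in>set ys. \<tau> y \<in> U) \<and> (\<forall>y. y \<notin> set ys \<longrightarrow> \<tau> y = \<sigma> y) \<longrightarrow> sat U N \<nu> \<tau> \<phi>)"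
proof (induction ys arbitrary: \<sigma>)
  case Nil
  have "(\<forall>y. \<tau> y = \<sigma> y) \<longleftrightarrow> \<tau> = \<sigma>" for \<tau> by auto
  then show ?case by (simp add: foralls_def)
next
  case (Cons z ys)
  have "sat U N \<nu> \<sigma> (foralls (z # ys) \<phi>) \<longleftrightarrow> (\<forall>u\<in>U. sat U N \<nu> (\<sigma>(z := u)) (foralls ys \<phi>))"
    by (simp add: foralls_def)
  also have "\<dots> \<longleftrightarrow> (\<forall>u\<in>U. \<forall>\<tau>. (\<forall>y\<in>set ys. \<tau> y \<in> U) \<and>
      (\<forall>y. y \<notin> set ys \<longrightarrow> \<tau> y = (\<sigma>(z := u)) y) \<longrightarrow> sat U N \<nu> \<tau> \<phi>)"
    using Cons.IH by simp
  also have "\<dots> \<longleftrightarrow> (\<forall>\<tau>. (\<exists>u\<in>U. (\<forall>y\<in>set ys. \<tau> y \<in> U) \<and>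
      (\<forall>y. y \<notin> set ys \<longrightarrow> \<tau> y = (\<sigma>(z := u)) y)) \<longrightarrow> sat U N \<nu> \<tau> \<phi>)"
    by blast
  also have "\<dots> \<longleftrightarrow> (\<forall>\<tau>. (\<forall>y\<in>set (z # ys). \<tau> y \<in> U) \<and>
      (\<forall>y. y \<notin> set (z # ys) \<longrightarrow> \<tau> y = \<sigma> y) \<longrightarrow> sat U N \<nu> \<tau> \<phi>)"
  proof -
    have "(\<exists>u\<in>U. (\<forall>y\<in>set ys. \<tau> y \<in> U) \<and> (\<forall>y. y \<notin> set ys \<longrightarrow> \<tau> y = (\<sigma>(z := u)) y)) \<longleftrightarrow>
        (\<forall>y\<in>set (z # ys). \<tau> y \<in> U) \<and> (\<forall>y. y \<notin> set (z # ys) \<longrightarrow> \<tau> y = \<sigma> y)" (is "?L \<longleftrightarrow> ?R") for \<tau>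
    proof
      assume ?L
      then show ?R by (auto split: if_splits)
    next
      assume ?R
      \<comment> \<open>The value chosen for the outermost variable is read off from
        \<open>\<tau>\<close>.\<close>
      then show ?L by (intro bexI[of _ "\<tau> z"]) auto
    qed
    then show ?thesis by simp
  qed
  finally show ?case .
qed

lemma sat_exists:
  "sat U N \<nu> \<sigma> (exists ys \<phi>) \<longleftrightarrow>
     (\<exists>\<tau>. (\<forall>y\<in>set ys. \<tau> y \<in> U) \<and> (\<forall>y. y \<notin> set ys \<longrightarrow> \<tau> y = \<sigma> y) \<and> sat U N \<nu> \<tau> \<phi>)"
proof -
  \<comment> \<open>By duality \<open>sat_foralls\<close> can be reused; the induction only moves
    the negation through the block.\<close>
  have "sat U N \<nu> \<sigma> (exists ys \<phi>) \<longleftrightarrow> \<not> sat U N \<nu> \<sigma> (foralls ys (Neg \<phi>))"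
    by (induction ys arbitrary: \<sigma>) (simp_all add: exists_def foralls_def)
  then show ?thesis by (auto simp: sat_foralls)
qed

text \<open>\<open>is_model\<close> already ranges over all assignments into \<open>U\<close>, and
  changing such an assignment on \<open>ys\<close> within \<open>U\<close> gives another one, so a
  universal prefix adds nothing.\<close>

lemma is_model_foralls:
  "is_model U N (foralls ys \<phi>) \<longleftrightarrow> (\<forall>\<nu> \<sigma>. (\<forall>x. \<sigma> x \<in> U) \<longrightarrow> sat U N \<nu> \<sigma> \<phi>)"
proof
  assume "is_model U N (foralls ys \<phi>)"
  then show "\<forall>\<nu> \<sigma>. (\<forall>x. \<sigma> x \<in> U) \<longrightarrow> sat U N \<nu> \<sigma> \<phi>"
    by (fastforce simp: is_model_def sat_foralls)
next
  assume *: "\<forall>\<nu> \<sigma>. (\<forall>x. \<sigma> x \<in> U) \<longrightarrow> sat U N \<nu> \<sigma> \<phi>"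
  show "is_model U N (foralls ys \<phi>)"
    unfolding is_model_def sat_foralls
  proof (intro allI impI, elim conjE)
    fix \<nu> and \<sigma> \<tau> :: "var \<Rightarrow> 'a"
    assume "\<forall>x. \<sigma> x \<in> U" "\<forall>y\<in>set ys. \<tau> y \<in> U" "\<forall>y. y \<notin> set ys \<longrightarrow> \<tau> y = \<sigma> y"
    then have "\<forall>x. \<tau> x \<in> U" by metis
    then show "sat U N \<nu> \<tau> \<phi>" using * by simp
  qed
qed

lemma is_model_Conj: "is_model U N (Conj \<Phi>) \<longleftrightarrow> (\<forall>\<phi> |\<in>| \<Phi>. is_model U N \<phi>)"
  by (auto simp: is_model_def)

lemma map_upds:
  assumes "distinct xs" "length us = length xs"
  shows "map (upds \<sigma> xs us) xs = us"
  using assms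
  by (intro nth_equalityI) (simp_all add: upds_def map_of_zip_nth)

lemma upds_in_universe:
  assumes "\<forall>x. \<sigma> x \<in> U" "set us \<subseteq> U"
  shows "upds \<sigma> xs us x \<in> U"
  using assms by (auto simp: upds_def split: option.split dest!: map_of_SomeD set_zip_rightD)

lemma ball_zip:
  assumes "length xs = length ts"
  shows "(\<forall>x |\<in>| fset_of_list (zip xs ts). A x) \<longleftrightarrow> (\<forall>i<length xs. A (xs ! i, ts ! i))"
  using assms by (auto simp: fset_of_list.rep_eq set_zip)

subsection \<open>The completion of a \<open>p\<close>-program\<close>

locale p_program_interpretation =
  fixes P :: "('p, 'c trm) rule fset"
    and p :: 'p and n :: nat
    and U :: "'c set"
    and M :: "('p, 'c) atom set"
    and name :: "('p, 'c trm) rule \<Rightarrow> 'p"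
    and W :: pvar and xs :: "var list"
  assumes p_program: "p_program p n P"
    and universe: "universe P U"
    and M: "M \<subseteq> {Pred p cs | cs. length cs = n \<and> set cs \<subseteq> U}"
    and inj_name: "inj_on name (fset P)" and name_neq: "p \<notin> name ` fset P"
    and distinct_xs: "distinct xs" and length_xs: "length xs = n"
    and fresh_xs: "set xs \<inter> fset (prog_vars P) = {}"
begin

abbreviation N :: "('p, 'c) atom set" where
  "N \<equiv> M \<union> name_atoms name P U M"

section \<open>Program atoms, rule names and rules in the interpretation \<open>N\<close>\<close>

lemma is_rule: "r |\<in>| P \<Longrightarrow> is_rule r"
  using p_program by (simp add: p_program_def is_program_def)

lemma atom_cases:
  assumes "r |\<in>| P" "a |\<in>| atoms r"
  obtains (Pred) ts where "a = Pred p ts" "length ts = n" | (Eq) s t where "a = Eq s t"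
proof (cases a)
  case (Pred q ts)
  then have "(q, length ts) \<in> prog_preds P" using assms by (auto simp: prog_preds_def)
  then show thesis using that(1) Pred p_program by (auto simp: p_program_def)
qed (rule that(2))

lemma lit_atoms:
  "a |\<in>| pos (head r) \<Longrightarrow> a |\<in>| atoms r" "a |\<in>| pos (body r) \<Longrightarrow> a |\<in>| atoms r"
  "a |\<in>| neg (head r) \<Longrightarrow> a |\<in>| atoms r" "a |\<in>| neg (body r) \<Longrightarrow> a |\<in>| atoms r"
  for r :: "('p, 'c trm) rule"
  unfolding atoms_def mem_pos mem_neg by force+

lemma head_cases:
  assumes "r |\<in>| P" "a |\<in>| pos (head r)"
  obtains ts where "a = Pred p ts" "length ts = n"
proof (rule atom_cases[OF assms(1) lit_atoms(1)[OF assms(2)]])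
  fix s t assume "a = Eq s t"
  then show thesis using is_rule_regular[OF is_rule assms(2)] assms(1) by simp
qed

lemma name_atoms_neq: "Pred p cs \<notin> name_atoms name P U M"
  using name_neq by (auto simp: name_atoms_def)

text \<open>Atoms of \<open>P\<close> are equalities or atoms of \<open>p\<close>, and no rule name
  equals \<open>p\<close>; adding \<open>R\<close> therefore cannot change their truth.\<close>

lemma sat_atom_N:
  assumes "r |\<in>| P" "a |\<in>| atoms r"
  shows "sat_atom N (map_atom id (val \<sigma>) a) \<longleftrightarrow> sat_atom M (map_atom id (val \<sigma>) a)"
  by (rule atom_cases[OF assms]) (auto simp: name_atoms_neq)

lemma applicable_ground:
  "applicable M (ground_rule \<sigma> r) \<longleftrightarrow>
     (\<forall>a |\<in>| neg (head r). sat_atom M (map_atom id (val \<sigma>) a)) \<and>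
     (\<forall>a |\<in>| neg (body r). \<not> sat_atom M (map_atom id (val \<sigma>) a))"
  by (simp add: applicable_iff map_rule_sel neg_map)

text \<open>A name atom determines its ground rule: injectivity of \<open>name\<close> recovers
  \<open>r\<close>, and the tuple recovers the values of all its variables. Since \<open>M\<close>
  contains only atoms of \<open>p\<close>, the atom can only come from \<open>R\<close>.\<close>

lemma sat_name_fm:
  assumes "r |\<in>| P" "\<forall>x. \<sigma> x \<in> U"
  shows "sat U N \<nu> \<sigma> (name_fm name r) \<longleftrightarrow> applicable M (ground_rule \<sigma> r)"
proof -
  have "Pred (name r) (map \<sigma> (rule_vars r)) \<notin> M" using M name_neq assms(1) by auto
  moreover have "Pred (name r) (map \<sigma> (rule_vars r)) \<in> name_atoms name P U M \<longleftrightarrow>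
      applicable M (ground_rule \<sigma> r)" (is "?A \<in> _ \<longleftrightarrow> _")
  proof
    assume "?A \<in> name_atoms name P U M"
    then obtain r' \<tau> where r': "r' |\<in>| P" "name r = name r'"
        "map \<sigma> (rule_vars r) = map \<tau> (rule_vars r')" "applicable M (ground_rule \<tau> r')"
      by (auto simp: name_atoms_def applicable_def)
    then have "r' = r" using inj_name assms(1) by (metis inj_onD)
    then have "ground_rule \<tau> r' = ground_rule \<sigma> r"
      using r'(3) ground_rule_cong[of r \<tau> \<sigma>] by (simp add: set_rule_vars)
    then show "applicable M (ground_rule \<sigma> r)" using r'(4) by simp
  next
    assume "applicable M (ground_rule \<sigma> r)"
    then show "?A \<in> name_atoms name P U M"
      using assms by (auto simp: name_atoms_def applicable_def)
  qed
  ultimately show ?thesis by (simp add: name_fm_def comp_def)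
qed

text \<open>\<open>R\<close> is chosen to make these conjuncts true, so they impose no condition on
  \<open>M\<close>.\<close>

lemma is_model_gl_fm:
  assumes "r |\<in>| P"
  shows "is_model U N (gl_fm name r)"
  unfolding gl_fm_def is_model_foralls
  using assms lit_atoms(3,4)[of _ r]
  by (simp add: sat_name_fm applicable_ground ball_Un sat_atom_N)

lemma is_model_sat_fm:
  assumes "r |\<in>| P"
  shows "is_model U N (sat_fm r) \<longleftrightarrow> (\<forall>\<sigma>. (\<forall>x. \<sigma> x \<in> U) \<longrightarrow> sat_rule M (ground_rule \<sigma> r))"
proof -
  have lit: "sat U N \<nu> \<sigma> (lit_fm l) \<longleftrightarrow> sat_lit M (map_literal id (val \<sigma>) l)"
    if "l |\<in>| head r |\<union>| body r" for l \<nu> \<sigma>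
    using sat_atom_N[OF assms, of "atm l" \<sigma>] that by (cases l) (force simp: atoms_def)+
  show ?thesis
    unfolding sat_fm_def is_model_foralls
    by (simp add: sat_rule_def sat_lits_def map_rule_sel lit)
qed

section \<open>The fixed point formula as an operator on tuples\<close>

definition step :: "'c list set \<Rightarrow> 'c list set" where
  "step S = S \<union> {us. Pred p us \<in> consequences (ground P U) M (Pred p ` S)}"

lemma consequences_ground:
  "a \<in> consequences (ground P U) M S \<longleftrightarrow>
     (\<exists>r ts \<sigma>. r |\<in>| P \<and> Pred p ts |\<in>| pos (head r) \<and> (\<forall>x. \<sigma> x \<in> U) \<and>
       a = Pred p (map (val \<sigma>) ts) \<and> applicable M (ground_rule \<sigma> r) \<and>
       sat_pos_body S (ground_rule \<sigma> r))" (is "?L \<longleftrightarrow> ?R")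
proof
  assume ?L
  then obtain r \<sigma> b where r: "r |\<in>| P" "\<forall>x. \<sigma> x \<in> U" "applicable M (ground_rule \<sigma> r)"
      "sat_pos_body S (ground_rule \<sigma> r)" "b |\<in>| pos (head r)" "a = map_atom id (val \<sigma>) b"
    by (auto simp: consequences_def ground_alt[OF universe] map_rule_sel pos_map)
  moreover obtain ts where "b = Pred p ts" by (rule head_cases[OF r(1,5)])
  ultimately show ?R by auto
next
  assume ?R
  then obtain r ts \<sigma> where r: "r |\<in>| P" "Pred p ts |\<in>| pos (head r)" "\<forall>x. \<sigma> x \<in> U"
      "a = Pred p (map (val \<sigma>) ts)" "applicable M (ground_rule \<sigma> r)"
      "sat_pos_body S (ground_rule \<sigma> r)"
    by blast
  then have "a |\<in>| pos (head (ground_rule \<sigma> r))"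
    by (force simp: map_rule_sel pos_map image_iff)
  then show ?L using r by (auto simp: consequences_def ground_alt[OF universe])
qed

text \<open>Derived atoms are ground rule heads, and constants of \<open>P\<close> lie in
  \<open>U\<close>, so their tuples stay in the universe. The last fact, that \<open>p\<close>
  occurs in \<open>P\<close>, serves the condition on predicates in
  \<open>open_answer_set\<close>.\<close>

lemma consequences_tuple:
  assumes "a \<in> consequences (ground P U) M S"
  obtains us where "a = Pred p us" "length us = n" "set us \<subseteq> U" "(p, n) \<in> prog_preds P"
proof -
  obtain r ts \<sigma> where r: "r |\<in>| P" "Pred p ts |\<in>| pos (head r)" "\<forall>x. \<sigma> x \<in> U"
      "a = Pred p (map (val \<sigma>) ts)"
    using assms by (auto simp: consequences_ground)
  have at: "Pred p ts |\<in>| atoms r" using r(2) by (rule lit_atoms)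
  have len: "length ts = n" by (rule head_cases[OF r(1,2)]) simp
  show thesis
  proof (rule that[OF r(4)])
    show "set (map (val \<sigma>) ts) \<subseteq> U" using val_in_universe[OF universe r(1) at _ r(3)] by auto
    show "(p, n) \<in> prog_preds P" using at r(1) len by (auto simp: prog_preds_def)
  qed (simp add: len)
qed

lemma sat_repl:
  assumes "r |\<in>| P" "a |\<in>| atoms r"
  shows "sat U N (\<nu>(W := S)) \<sigma> (repl p W a) \<longleftrightarrow> sat_atom (Pred p ` S) (map_atom id (val \<sigma>) a)"
  by (rule atom_cases[OF assms]) auto

text \<open>The new variables \<open>xs\<close> carry the tuple \<open>us\<close>, and the
  existential block over \<open>rule_vars r\<close> chooses the grounding. The equations make the
  ground head atom equal to \<open>p(us)\<close>, the replaced body reads its atoms of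
  \<open>p\<close> from \<open>S\<close>, and the name predicate expresses applicability.\<close>

lemma sat_E_fm:
  assumes r: "r |\<in>| P" "Pred p ts |\<in>| pos (head r)"
    and us: "length us = n" "set us \<subseteq> U" and \<sigma>: "\<forall>x. \<sigma> x \<in> U"
  shows "sat U N (\<nu>(W := S)) (upds \<sigma> xs us) (E_fm p name W xs r ts) \<longleftrightarrow>
    (\<exists>\<tau>. (\<forall>x. \<tau> x \<in> U) \<and> us = map (val \<tau>) ts \<and> applicable M (ground_rule \<tau> r) \<and>
       sat_pos_body (Pred p ` S) (ground_rule \<tau> r))" (is "?L \<longleftrightarrow> ?R")
proof -
  let ?\<sigma> = "upds \<sigma> xs us"
  have \<sigma>U: "?\<sigma> x \<in> U" for x by (rule upds_in_universe[OF \<sigma> us(2)])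
  have len: "length xs = length ts" by (rule head_cases[OF r]) (simp add: length_xs)
  have xs_us: "map ?\<sigma> xs = us" using map_upds[OF distinct_xs] us(1) length_xs by simp
  have fresh: "x \<notin> set (rule_vars r)" if "x \<in> set xs" for x
  proof
    assume "x \<in> set (rule_vars r)"
    then have "x |\<in>| prog_vars P"
      using r(1) by (auto simp: set_rule_vars prog_vars_def ffUnion.rep_eq)
    then show False using fresh_xs that by auto
  qed
  \<comment> \<open>By freshness, the block over the variables of \<open>r\<close> leaves the values
    of \<open>xs\<close> untouched, so they still spell out \<open>us\<close>.\<close>
  have eqs: "(\<forall>i<length xs. \<tau> (xs ! i) = val \<tau> (ts ! i)) \<longleftrightarrow> us = map (val \<tau>) ts"
    if "\<forall>y. y \<notin> set (rule_vars r) \<longrightarrow> \<tau> y = ?\<sigma> y" for \<tau>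
  proof -
    have "map \<tau> xs = map ?\<sigma> xs" using that fresh by simp
    then have "us = map \<tau> xs" unfolding xs_us by simp
    then show ?thesis using len by (simp add: list_eq_iff_nth_eq)
  qed
  have "sat U N (\<nu>(W := S)) \<tau> (Conj (fset_of_list (map2 (\<lambda>x t. Atom (Eq (Var x) t)) xs ts) |\<union>|
        repl p W |`| pos (body r) |\<union>| {|name_fm name r|})) \<longleftrightarrow>
      us = map (val \<tau>) ts \<and> sat_pos_body (Pred p ` S) (ground_rule \<tau> r) \<and>
      applicable M (ground_rule \<tau> r)"
    if \<tau>: "\<forall>x. \<tau> x \<in> U" "\<forall>y. y \<notin> set (rule_vars r) \<longrightarrow> \<tau> y = ?\<sigma> y" for \<tau>
    using sat_repl[OF r(1) lit_atoms(2)]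
    by (auto simp: ball_Un ball_zip[OF len] eqs[OF \<tau>(2)] sat_name_fm[OF r(1) \<tau>(1)]
        sat_pos_body_def map_rule_sel pos_map del: fun_upd_apply)
  moreover have "(\<forall>y\<in>set (rule_vars r). \<tau> y \<in> U) \<longleftrightarrow> (\<forall>x. \<tau> x \<in> U)"
    if "\<forall>y. y \<notin> set (rule_vars r) \<longrightarrow> \<tau> y = ?\<sigma> y" for \<tau>
    using that \<sigma>U by metis
  ultimately have L: "?L \<longleftrightarrow> (\<exists>\<tau>. (\<forall>x. \<tau> x \<in> U) \<and> (\<forall>y. y \<notin> set (rule_vars r) \<longrightarrow> \<tau> y = ?\<sigma> y) \<and>
      us = map (val \<tau>) ts \<and> sat_pos_body (Pred p ` S) (ground_rule \<tau> r) \<and>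
      applicable M (ground_rule \<tau> r))"
    unfolding E_fm_def sat_exists by (intro ex_cong1) blast
  show ?thesis
  proof
    assume ?L
    then show ?R unfolding L by blast
  next
    assume ?R
    then obtain \<tau> where \<tau>: "\<forall>x. \<tau> x \<in> U" "us = map (val \<tau>) ts" "applicable M (ground_rule \<tau> r)"
        "sat_pos_body (Pred p ` S) (ground_rule \<tau> r)"
      by blast
    \<comment> \<open>The block may change only variables of \<open>r\<close>, so elsewhere the
      witness has to follow the enclosing assignment. This affects neither the ground rule nor the
      head arguments.\<close>
    let ?\<tau> = "\<lambda>x. if x |\<in>| vars r then \<tau> x else ?\<sigma> x"
    have "ground_rule ?\<tau> r = ground_rule \<tau> r" by (rule ground_rule_cong) simp
    moreover have "val ?\<tau> t = val \<tau> t" if "t \<in> set ts" for t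
      using trms_fv_args[of "Pos (Pred p ts)" r] r(2) that
      by (intro val_cong) (force simp: mem_pos trms_fv_def)
    then have "map (val ?\<tau>) ts = map (val \<tau>) ts" by simp
    ultimately show ?L
      unfolding L using \<tau> \<sigma>U by (intro exI[of _ ?\<tau>]) (simp add: set_rule_vars)
  qed
qed

text \<open>The disjunct \<open>W(X)\<close> yields the summand \<open>S\<close> of
  \<open>step S\<close>; the disjuncts \<open>E(r)\<close> together yield the consequences.\<close>

lemma sat_phi_fm:
  assumes us: "length us = n" "set us \<subseteq> U" and \<sigma>: "\<forall>x. \<sigma> x \<in> U"
  shows "sat U N (\<nu>(W := S)) (upds \<sigma> xs us) (phi_fm p name W xs P) \<longleftrightarrow> us \<in> step S"
proof -
  have "map (val (upds \<sigma> xs us)) (map Var xs) = us"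
    using map_upds[OF distinct_xs] us(1) length_xs by (simp add: comp_def)
  moreover have "(\<exists>\<phi> |\<in>| ffUnion ((\<lambda>r. (\<lambda>a. E_fm p name W xs r (args a)) |`|
       ffilter (\<lambda>a. \<exists>ts. a = Pred p ts) (pos (head r))) |`| P). A \<phi>) \<longleftrightarrow>
      (\<exists>r ts. r |\<in>| P \<and> Pred p ts |\<in>| pos (head r) \<and> A (E_fm p name W xs r ts))" for A
    by (force simp: ffUnion.rep_eq)
  ultimately have "sat U N (\<nu>(W := S)) (upds \<sigma> xs us) (phi_fm p name W xs P) \<longleftrightarrow> us \<in> S \<or>
      (\<exists>r ts. r |\<in>| P \<and> Pred p ts |\<in>| pos (head r) \<and>
        sat U N (\<nu>(W := S)) (upds \<sigma> xs us) (E_fm p name W xs r ts))"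
    unfolding phi_fm_def by simp
  then show ?thesis
    by (simp add: step_def consequences_ground sat_E_fm[OF _ _ assms] cong: conj_cong)
qed

text \<open>Each least fixed point, transported along \<open>Pred p\<close>, is closed under the
  other operator. The additional summand \<open>S\<close> in \<open>step\<close> is harmless, since
  it never takes a closed set beyond itself.\<close>

lemma lfp_step:
  "Pred p us \<in> lfp (consequences (ground P U) M) \<longleftrightarrow>
     us \<in> lfp (\<lambda>S. {us. length us = n \<and> set us \<subseteq> U \<and> us \<in> step S})"
proof -
  let ?F = "consequences (ground P U) M"
  let ?G = "\<lambda>S. {us. length us = n \<and> set us \<subseteq> U \<and> us \<in> step S}"
  have "mono ?G"
  proof (rule monoI)
    fix S T :: "'c list set" assume "S \<subseteq> T"
    moreover from this have "?F (Pred p ` S) \<subseteq> ?F (Pred p ` T)"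
      by (intro monoD[OF mono_consequences] image_mono)
    ultimately show "?G S \<subseteq> ?G T" by (auto simp: step_def)
  qed
  then have G: "?G (lfp ?G) = lfp ?G" by (rule lfp_fixpoint)
  have F: "?F (lfp ?F) = lfp ?F" by (simp add: lfp_fixpoint mono_consequences)
  have "lfp ?F \<subseteq> Pred p ` lfp ?G"
  proof (rule lfp_lowerbound, rule subsetI)
    fix a assume a: "a \<in> ?F (Pred p ` lfp ?G)"
    then obtain us where "a = Pred p us" "length us = n" "set us \<subseteq> U" by (rule consequences_tuple)
    then have "us \<in> ?G (lfp ?G)" using a by (simp add: step_def)
    then show "a \<in> Pred p ` lfp ?G" unfolding G using \<open>a = Pred p us\<close> by simp
  qed
  moreover have "lfp ?G \<subseteq> {us. Pred p us \<in> lfp ?F}"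
  proof (rule lfp_lowerbound, rule subsetI)
    let ?S = "{us. Pred p us \<in> lfp ?F}"
    fix us assume "us \<in> ?G ?S"
    moreover have "?F (Pred p ` ?S) \<subseteq> ?F (lfp ?F)" by (intro monoD[OF mono_consequences]) auto
    ultimately show "us \<in> ?S" unfolding F by (auto simp: step_def)
  qed
  ultimately show ?thesis by auto
qed

lemma sat_Lfp:
  assumes "\<forall>x. \<sigma> x \<in> U"
  shows "sat U N \<nu> \<sigma> (Lfp W xs (phi_fm p name W xs P) (map Var xs)) \<longleftrightarrow>
    Pred p (map \<sigma> xs) \<in> lfp (consequences (ground P U) M)"
proof -
  have "(\<lambda>S. {us. length us = length xs \<and> set us \<subseteq> U \<and>
      sat U N (\<nu>(W := S)) (upds \<sigma> xs us) (phi_fm p name W xs P)}) =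
    (\<lambda>S. {us. length us = n \<and> set us \<subseteq> U \<and> us \<in> step S})"
    using sat_phi_fm[OF _ _ assms] length_xs by blast
  then show ?thesis by (simp add: lfp_step comp_def)
qed

text \<open>Name atoms are not atoms of \<open>p\<close>, so the premise of the implication speaks
  of \<open>M\<close> alone, and every tuple of an atom of \<open>M\<close> is the value of
  \<open>xs\<close> under some assignment into \<open>U\<close>.\<close>

lemma is_model_fp_fm:
  "is_model U N (fp_fm p name W xs P) \<longleftrightarrow> M \<subseteq> lfp (consequences (ground P U) M)"
    (is "_ \<longleftrightarrow> M \<subseteq> ?L")
proof -
  have "is_model U N (fp_fm p name W xs P) \<longleftrightarrow>
      (\<forall>\<sigma>. (\<forall>x. \<sigma> x \<in> U) \<longrightarrow> Pred p (map \<sigma> xs) \<in> M \<longrightarrow> Pred p (map \<sigma> xs) \<in> ?L)"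
    unfolding fp_fm_def is_model_foralls
    by (simp add: sat_Lfp name_atoms_neq comp_def del: sat.simps(10))
  also have "\<dots> \<longleftrightarrow> M \<subseteq> ?L"
  proof
    assume *: "\<forall>\<sigma>. (\<forall>x. \<sigma> x \<in> U) \<longrightarrow> Pred p (map \<sigma> xs) \<in> M \<longrightarrow> Pred p (map \<sigma> xs) \<in> ?L"
    show "M \<subseteq> ?L"
    proof
      fix a assume a: "a \<in> M"
      then obtain us where us: "a = Pred p us" "length us = n" "set us \<subseteq> U" using M by blast
      obtain u where "u \<in> U" using universe by (auto simp: universe_def)
      \<comment> \<open>The default \<open>u\<close> keeps the variables outside \<open>xs\<close>
        inside the universe.\<close>
      let ?\<sigma> = "upds (\<lambda>_. u) xs us"
      have "\<forall>x. ?\<sigma> x \<in> U" using upds_in_universe \<open>u \<in> U\<close> us(3) by metis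
      moreover have "map ?\<sigma> xs = us" using map_upds[OF distinct_xs] us(2) length_xs by simp
      ultimately show "a \<in> ?L" using * a us(1) by metis
    qed
  qed auto
  finally show ?thesis .
qed

section \<open>Comparison of the completion with open answer sets\<close>

lemma is_model_completion:
  "is_model U N (Conj (completion p name W xs P)) \<longleftrightarrow>
     (\<forall>\<rho>\<in>ground P U. sat_rule M \<rho>) \<and> M \<subseteq> lfp (consequences (ground P U) M)"
proof -
  \<comment> \<open>The existence axiom holds because \<open>U\<close> is non-empty, the
    inequalities because constants denote themselves. With \<open>is_model_gl_fm\<close>, only the
    rule formulas and the fixed point formula remain as conditions on \<open>M\<close>.\<close>
  have "is_model U N (Exists 0 (Conj {||}))"
    using universe by (auto simp: is_model_def universe_def)
  moreover have "is_model U N \<phi>" if "\<phi> |\<in>| ffUnion ((\<lambda>a. (\<lambda>b. Neg (Atom (Eq (Const a) (Const b)))) |`|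
       ffilter (\<lambda>b. a \<noteq> b) (prog_consts P)) |`| prog_consts P)" for \<phi>
    using that by (auto simp: ffUnion.rep_eq is_model_def)
  ultimately have "is_model U N (Conj (completion p name W xs P)) \<longleftrightarrow>
      (\<forall>r |\<in>| P. is_model U N (sat_fm r)) \<and> is_model U N (fp_fm p name W xs P)"
    unfolding is_model_Conj completion_def using is_model_gl_fm by (auto simp: ball_Un)
  moreover have "(\<forall>r |\<in>| P. is_model U N (sat_fm r)) \<longleftrightarrow> (\<forall>\<rho>\<in>ground P U. sat_rule M \<rho>)"
    by (auto simp: is_model_sat_fm ground_alt[OF universe]; blast)
  ultimately show ?thesis by (simp add: is_model_fp_fm)
qed

lemma open_answer_set_iff:
  "open_answer_set P U M \<longleftrightarrow>
     (\<forall>\<rho>\<in>ground P U. sat_rule M \<rho>) \<and> M \<subseteq> lfp (consequences (ground P U) M)"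
proof -
  let ?L = "lfp (consequences (ground P U) M)"
  have "is_rule \<rho>" if "\<rho> \<in> ground P U" for \<rho>
    using that by (auto simp: ground_def intro: is_rule_ground is_rule)
  moreover have "\<forall>a\<in>M. regular a" using M by auto
  ultimately have "answer_set (ground P U) M \<longleftrightarrow> (\<forall>\<rho>\<in>ground P U. sat_rule M \<rho>) \<and> M \<subseteq> ?L"
    by (rule answer_set_iff_lfp)
  \<comment> \<open>The locale assumption allows atoms of \<open>p\<close> in \<open>M\<close> even
    if \<open>p\<close> does not occur in \<open>P\<close>. Containment in the least fixed point
    excludes this, as each atom of \<open>M\<close> is then the head of a ground rule.\<close>
  moreover have "M \<subseteq> {Pred q cs | q cs. (q, length cs) \<in> prog_preds P \<and> set cs \<subseteq> U}" if "M \<subseteq> ?L"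
  proof
    fix a assume "a \<in> M"
    then have "a \<in> consequences (ground P U) M ?L"
      using that lfp_fixpoint[OF mono_consequences, of "ground P U" M] by auto
    then show "a \<in> {Pred q cs | q cs. (q, length cs) \<in> prog_preds P \<and> set cs \<subseteq> U}"
      by (rule consequences_tuple) auto
  qed
  ultimately show ?thesis using universe by (auto simp: open_answer_set_def)
qed

end

theorem theorem3p8:
  fixes P :: "('p, 'c trm) rule fset"
    and p :: 'p and n :: nat
    and U :: "'c set"
    and M :: "('p, 'c) atom set"
    and name :: "('p, 'c trm) rule \<Rightarrow> 'p"
    and W :: pvar and xs :: "var list"
  assumes "p_program p n P"
    and "universe P U"
    and "M \<subseteq> {Pred p cs | cs. length cs = n \<and> set cs \<subseteq> U}"
    and "inj_on name (fset P)" and "p \<notin> name ` fset P"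
    and "distinct xs" and "length xs = n" and "set xs \<inter> fset (prog_vars P) = {}"
  shows "open_answer_set P U M \<longleftrightarrow>
    is_model U (M \<union> name_atoms name P U M) (Conj (completion p name W xs P))"
proof -
  interpret p_program_interpretation P p n U M name W xs
    using assms by unfold_locales
  show ?thesis by (simp only: open_answer_set_iff is_model_completion)
qed

end
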